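(* Let $P'_1, P'_2$ be definite clause logic programs. For $i=1,2$ let $F_i$ be the set of the predicate symbols occurring in $P'_i$, and assume that $F_1\cap F_2=\emptyset$. Call an atom $A$ an $F_i$-atom if the predicate symbol of $A$ is in $F_i$. Assume that each variable occurring in a rule of $P'_1$ occurs in the head of that rule, and each variable occurring in a rule of $P'_2$ occurs in the body of that rule. Let $\mathcal{R}$ be a partial selection rule under which each floundered query consists solely of non-ground $F_1$-atoms. Let $Q$ be a query such that each variable of $Q$ occurs in an $F_2$-atom of $Q$. Then no derivation of $P'_1\cup P'_2$ for $Q$ via $\mathcal{R}$ flounders.
   Context: Programs are sets of definite clauses, called rules, $H\gets B_1,\ldots,B_n$ ($n\ge 0$) with head $H$ and body $B_1,\ldots,B_n$; queries are finite sequences of atoms. Derivations are SLD-derivations (with rules renamed apart and most general unifiers in each step), generalized so that the selection rule may be a partial function (a partial selection rule): in some non-empty queries no atom may be selected. A non-empty query in which no atom is selected is called floundered. A derivation flounders if a floundered query occurs in it. *)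

theory Defs
  imports Main "HOL-Library.Extended_Nat"
begin

datatype (funs_trm: 'f, vars_trm: 'v) trm =
  Var 'v | Fun 'f "('f, 'v) trm list"

datatype ('p, 'f, 'v) atom = Atom (pred_name: 'p) (args: "('f, 'v) trm list")

type_synonym ('p, 'f, 'v) query = "('p, 'f, 'v) atom list"

datatype ('p, 'f, 'v) rule = Rule (head: "('p, 'f, 'v) atom") (body: "('p, 'f, 'v) query")

type_synonym ('p, 'f, 'v) program = "('p, 'f, 'v) rule set"

text \<open>A predicate symbol is a name together with its arity: equal names applied to
  different numbers of arguments are distinct symbols.\<close>

type_synonym 'p pred_sym = "'p \<times> nat"

definition pred_sym :: "('p, 'f, 'v) atom \<Rightarrow> 'p pred_sym" where
  "pred_sym A = (pred_name A, length (args A))"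

definition preds_rule :: "('p, 'f, 'v) rule \<Rightarrow> 'p pred_sym set" where
  "preds_rule C = pred_sym ` (insert (head C) (set (body C)))"

definition preds :: "('p, 'f, 'v) program \<Rightarrow> 'p pred_sym set" where
  "preds P = (\<Union>C\<in>P. preds_rule C)"

definition vars_atom :: "('p, 'f, 'v) atom \<Rightarrow> 'v set" where
  "vars_atom A = (\<Union>t\<in>set (args A). vars_trm t)"

definition vars_query :: "('p, 'f, 'v) query \<Rightarrow> 'v set" where
  "vars_query Q = (\<Union>A\<in>set Q. vars_atom A)"

definition vars_rule :: "('p, 'f, 'v) rule \<Rightarrow> 'v set" where
  "vars_rule C = vars_atom (head C) \<union> vars_query (body C)"

definition ground_atom :: "('p, 'f, 'v) atom \<Rightarrow> bool" where
  "ground_atom A \<longleftrightarrow> vars_atom A = {}"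

type_synonym ('f, 'v) subst = "'v \<Rightarrow> ('f, 'v) trm"

definition dom_subst :: "('f, 'v) subst \<Rightarrow> 'v set" where
  "dom_subst \<theta> = {x. \<theta> x \<noteq> Var x}"

definition vars_subst :: "('f, 'v) subst \<Rightarrow> 'v set" where
  "vars_subst \<theta> = dom_subst \<theta> \<union> (\<Union>x\<in>dom_subst \<theta>. vars_trm (\<theta> x))"

text \<open>Substitutions proper are the functions with finite domain.\<close>

definition is_subst :: "('f, 'v) subst \<Rightarrow> bool" where
  "is_subst \<theta> \<longleftrightarrow> finite (dom_subst \<theta>)"

primrec subst_trm :: "('f, 'v) subst \<Rightarrow> ('f, 'v) trm \<Rightarrow> ('f, 'v) trm" where
  "subst_trm \<theta> (Var x) = \<theta> x"
| "subst_trm \<theta> (Fun f ts) = Fun f (map (subst_trm \<theta>) ts)"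

definition subst_atom :: "('f, 'v) subst \<Rightarrow> ('p, 'f, 'v) atom \<Rightarrow> ('p, 'f, 'v) atom" where
  "subst_atom \<theta> A = Atom (pred_name A) (map (subst_trm \<theta>) (args A))"

definition subst_query :: "('f, 'v) subst \<Rightarrow> ('p, 'f, 'v) query \<Rightarrow> ('p, 'f, 'v) query" where
  "subst_query \<theta> Q = map (subst_atom \<theta>) Q"

definition subst_rule :: "('f, 'v) subst \<Rightarrow> ('p, 'f, 'v) rule \<Rightarrow> ('p, 'f, 'v) rule" where
  "subst_rule \<theta> C = Rule (subst_atom \<theta> (head C)) (subst_query \<theta> (body C))"

definition unifier :: "('f, 'v) subst \<Rightarrow> ('p, 'f, 'v) atom \<Rightarrow> ('p, 'f, 'v) atom \<Rightarrow> bool" where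
  "unifier \<theta> A B \<longleftrightarrow> is_subst \<theta> \<and> subst_atom \<theta> A = subst_atom \<theta> B"

definition mgu :: "('f, 'v) subst \<Rightarrow> ('p, 'f, 'v) atom \<Rightarrow> ('p, 'f, 'v) atom \<Rightarrow> bool" where
  "mgu \<theta> A B \<longleftrightarrow> unifier \<theta> A B \<and>
     (\<forall>\<sigma>. unifier \<sigma> A B \<longrightarrow> (\<exists>\<gamma>. is_subst \<gamma> \<and> \<sigma> = (\<lambda>x. subst_trm \<gamma> (\<theta> x))))"

definition variant :: "('p, 'f, 'v) rule \<Rightarrow> ('p, 'f, 'v) rule \<Rightarrow> bool" where
  "variant C' C \<longleftrightarrow>
     (\<exists>\<pi>. bij \<pi> \<and> finite {x. \<pi> x \<noteq> x} \<and> C' = subst_rule (\<lambda>x. Var (\<pi> x)) C)"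

text \<open>A finite or infinite sequence of steps: \<open>query_at D i\<close> is meaningful for
  \<open>i \<le> len D\<close>, while \<open>sel_at D i\<close> (position of the selected atom in \<open>query_at D i\<close>),
  \<open>clause_at D i\<close> and \<open>mgu_at D i\<close>, which lead from \<open>query_at D i\<close> to
  \<open>query_at D (Suc i)\<close>, are meaningful for \<open>i < len D\<close>.\<close>

record ('p, 'f, 'v) derivation =
  query_at :: "nat \<Rightarrow> ('p, 'f, 'v) query"
  sel_at :: "nat \<Rightarrow> nat"
  clause_at :: "nat \<Rightarrow> ('p, 'f, 'v) rule"
  mgu_at :: "nat \<Rightarrow> ('f, 'v) subst"
  len :: enat

definition sld_step ::
  "('p, 'f, 'v) query \<Rightarrow> nat \<Rightarrow> ('p, 'f, 'v) rule \<Rightarrow> ('f, 'v) subst \<Rightarrow> ('p, 'f, 'v) query \<Rightarrow> bool"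
where
  "sld_step Q k C \<theta> Q' \<longleftrightarrow> k < length Q \<and> mgu \<theta> (Q ! k) (head C) \<and>
     Q' = subst_query \<theta> (take k Q @ body C @ drop (Suc k) Q)"

text \<open>Input clauses are renamed apart from the initial query and from all clauses and
  substitutions used earlier. Derivations need not be maximal.\<close>

definition sld_derivation :: "('p, 'f, 'v) program \<Rightarrow> ('p, 'f, 'v) derivation \<Rightarrow> bool" where
  "sld_derivation P D \<longleftrightarrow> (\<forall>i. enat i < len D \<longrightarrow>
     sld_step (query_at D i) (sel_at D i) (clause_at D i) (mgu_at D i) (query_at D (Suc i)) \<and>
     (\<exists>C\<in>P. variant (clause_at D i) C) \<and>
     vars_rule (clause_at D i) \<inter>
       (vars_query (query_at D 0) \<union>
        (\<Union>j<i. vars_rule (clause_at D j) \<union> vars_subst (mgu_at D j))) = {})"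

text \<open>What a selection rule may depend on: the initial query and the steps made so far,
  each given by selected position, input clause, mgu and resulting query.\<close>

type_synonym ('p, 'f, 'v) fragment =
  "('p, 'f, 'v) query \<times> (nat \<times> ('p, 'f, 'v) rule \<times> ('f, 'v) subst \<times> ('p, 'f, 'v) query) list"

definition fragment :: "('p, 'f, 'v) derivation \<Rightarrow> nat \<Rightarrow> ('p, 'f, 'v) fragment" where
  "fragment D n = (query_at D 0,
     map (\<lambda>i. (sel_at D i, clause_at D i, mgu_at D i, query_at D (Suc i))) [0..<n])"

definition last_query :: "('p, 'f, 'v) fragment \<Rightarrow> ('p, 'f, 'v) query" where
  "last_query F =
     (if snd F = [] then fst F else (case last (snd F) of (k, C, \<theta>, Q) \<Rightarrow> Q))"

type_synonym ('p, 'f, 'v) selection = "('p, 'f, 'v) fragment \<Rightarrow> nat option"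

definition partial_selection_rule :: "('p, 'f, 'v) selection \<Rightarrow> bool" where
  "partial_selection_rule R \<longleftrightarrow> (\<forall>F k. R F = Some k \<longrightarrow> k < length (last_query F))"

definition derivation_via ::
  "('p, 'f, 'v) program \<Rightarrow> ('p, 'f, 'v) selection \<Rightarrow> ('p, 'f, 'v) derivation \<Rightarrow> bool"
where
  "derivation_via P R D \<longleftrightarrow> sld_derivation P D \<and>
     (\<forall>i. enat i < len D \<longrightarrow> R (fragment D i) = Some (sel_at D i))"

definition floundered_at ::
  "('p, 'f, 'v) selection \<Rightarrow> ('p, 'f, 'v) derivation \<Rightarrow> nat \<Rightarrow> bool"
where
  "floundered_at R D i \<longleftrightarrow>
     enat i \<le> len D \<and> query_at D i \<noteq> [] \<and> R (fragment D i) = None"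

definition flounders :: "('p, 'f, 'v) selection \<Rightarrow> ('p, 'f, 'v) derivation \<Rightarrow> bool" where
  "flounders R D \<longleftrightarrow> (\<exists>i. floundered_at R D i)"

end

theory Submission
  imports Defs
begin

text \<open>Along a derivation every variable of the query stays in some atom with predicate symbol
  in \<open>F2\<close>. Resolving with a rule of \<open>P1\<close> removes no \<open>F2\<close>-atom and only passes on variables of the
  selected atom; resolving with a rule of \<open>P2\<close> puts all variables of the removed atom into the
  new body, which consists of \<open>F2\<close>-atoms. A floundered query of non-ground \<open>F1\<close>-atoms would
  contain a variable not covered in this way.\<close>

lemma vars_subst_trm: "vars_trm (subst_trm \<theta> t) = (\<Union>x\<in>vars_trm t. vars_trm (\<theta> x))"
  by (induction t) auto

lemma vars_subst_atom: "vars_atom (subst_atom \<theta> A) = (\<Union>x\<in>vars_atom A. vars_trm (\<theta> x))"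
  by (auto simp: vars_atom_def subst_atom_def vars_subst_trm)

lemma vars_subst_query: "vars_query (subst_query \<theta> Q) = (\<Union>x\<in>vars_query Q. vars_trm (\<theta> x))"
  by (auto simp: vars_query_def subst_query_def vars_subst_atom)

lemma vars_subst_rule: "vars_rule (subst_rule \<theta> C) = (\<Union>x\<in>vars_rule C. vars_trm (\<theta> x))"
  by (auto simp: vars_rule_def subst_rule_def vars_subst_atom vars_subst_query)

lemma pred_sym_subst_atom [simp]: "pred_sym (subst_atom \<theta> A) = pred_sym A"
  by (simp add: pred_sym_def subst_atom_def)

lemma preds_subst_rule: "preds_rule (subst_rule \<theta> C) = preds_rule C"
  by (simp add: preds_rule_def subst_rule_def subst_query_def image_image)

lemma preds_variant: "variant C' C \<Longrightarrow> preds_rule C' = preds_rule C"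
  by (auto simp: variant_def preds_subst_rule)

text \<open>The variables after a substitution depend monotonically on those before it, so the
  inclusion passes from a program rule to its renamed input clause.\<close>

lemma variant_vars_head:
  assumes "variant C' C" "vars_rule C \<subseteq> vars_atom (head C)"
  shows "vars_rule C' \<subseteq> vars_atom (head C')"
proof -
  obtain \<theta> where C': "C' = subst_rule \<theta> C"
    using assms(1) by (auto simp: variant_def)
  have "head C' = subst_atom \<theta> (head C)"
    by (simp add: C' subst_rule_def)
  then show ?thesis
    using assms(2) by (auto simp: C' vars_subst_rule vars_subst_atom)
qed

lemma variant_vars_body:
  assumes "variant C' C" "vars_rule C \<subseteq> vars_query (body C)"
  shows "vars_rule C' \<subseteq> vars_query (body C')"
proof -
  obtain \<theta> where C': "C' = subst_rule \<theta> C"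
    using assms(1) by (auto simp: variant_def)
  have "body C' = subst_query \<theta> (body C)"
    by (simp add: C' subst_rule_def)
  then show ?thesis
    using assms(2) by (auto simp: C' vars_subst_rule vars_subst_query)
qed

definition covered :: "'p pred_sym set \<Rightarrow> ('p, 'f, 'v) query \<Rightarrow> bool" where
  "covered F Q \<longleftrightarrow> (\<forall>x\<in>vars_query Q. \<exists>A\<in>set Q. pred_sym A \<in> F \<and> x \<in> vars_atom A)"

text \<open>Recasts the invariant as an inclusion between the variables of two queries, a form that
  substitutions preserve.\<close>

lemma covered_iff:
  "covered F Q \<longleftrightarrow> vars_query Q \<subseteq> vars_query (filter (\<lambda>A. pred_sym A \<in> F) Q)"
  by (auto simp: covered_def vars_query_def)

text \<open>Instantiation keeps predicate symbols, so it commutes with filtering by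
  \<open>F\<close>.\<close>

lemma covered_subst:
  assumes "vars_query (subst_query \<theta> Q)
    \<subseteq> vars_query (subst_query \<theta> (filter (\<lambda>A. pred_sym A \<in> F) Q))"
  shows "covered F (subst_query \<theta> Q)"
proof -
  have "filter (\<lambda>A. pred_sym A \<in> F) (subst_query \<theta> Q)
      = subst_query \<theta> (filter (\<lambda>A. pred_sym A \<in> F) Q)"
    by (simp add: subst_query_def filter_map comp_def)
  then show ?thesis
    using assms by (simp add: covered_iff)
qed

lemma covered_step:
  assumes step: "sld_step Q k C \<theta> Q'"
    and cov: "covered F Q"
    and C: "preds_rule C \<inter> F = {} \<and> vars_rule C \<subseteq> vars_atom (head C)
      \<or> preds_rule C \<subseteq> F \<and> vars_rule C \<subseteq> vars_query (body C)"
  shows "covered F Q'"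
proof -
  define L where "L = take k Q"
  define A where "A = Q ! k"
  define U where "U = drop (Suc k) Q"
  \<comment> \<open>The selected atom and the clause head agree only after \<open>\<theta>\<close>,
    so variables are compared in the instantiated queries.\<close>
  define V where "V q = vars_query (subst_query \<theta> (q :: ('a, 'b, 'c) query))" for q
  have Q: "Q = L @ A # U"
    using step by (simp add: sld_step_def L_def A_def U_def id_take_nth_drop)
  have Q': "Q' = subst_query \<theta> (L @ body C @ U)"
    using step by (simp add: sld_step_def L_def U_def)
  have unif: "subst_atom \<theta> A = subst_atom \<theta> (head C)"
    using step by (simp add: sld_step_def mgu_def unifier_def A_def)
  then have sym: "pred_sym A = pred_sym (head C)"
    by (metis pred_sym_subst_atom)
  have V_append: "V (q @ r) = V q \<union> V r" for q r
    by (auto simp: V_def subst_query_def vars_query_def)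
  have V_Cons: "V (B # q) = vars_atom (subst_atom \<theta> B) \<union> V q" and V_Nil: "V [] = {}" for B q
    by (auto simp: V_def subst_query_def vars_query_def)
  have V_head: "V [A] = V [head C]"
    by (simp add: V_def subst_query_def unif)
  have V_mono: "V q \<subseteq> V r" if "vars_query q \<subseteq> vars_query r" for q r
    using that by (auto simp: V_def vars_subst_query)
  \<comment> \<open>Coverage depends only on the set of atoms, so the selected atom may be moved to
    the front, apart from the context \<open>L\<close>, \<open>U\<close> that survives the
    step.\<close>
  have VQ: "V ([A] @ L @ U) \<subseteq> V (filter (\<lambda>A. pred_sym A \<in> F) ([A] @ L @ U))"
  proof (rule V_mono)
    have "set ([A] @ L @ U) = set Q"
      by (auto simp: Q)
    then have "covered F ([A] @ L @ U)"
      using cov by (simp only: covered_def vars_query_def)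
    then show "vars_query ([A] @ L @ U) \<subseteq> vars_query (filter (\<lambda>A. pred_sym A \<in> F) ([A] @ L @ U))"
      by (simp only: covered_iff)
  qed
  have "V (L @ body C @ U) \<subseteq> V (filter (\<lambda>A. pred_sym A \<in> F) (L @ body C @ U))"
    using C
  proof
    assume *: "preds_rule C \<inter> F = {} \<and> vars_rule C \<subseteq> vars_atom (head C)"
    \<comment> \<open>The new body brings in only variables of the instantiated \<open>A\<close>. As
      \<open>A\<close> is no \<open>F\<close>-atom, these are covered by \<open>F\<close>-atoms of
      \<open>L\<close> and \<open>U\<close>, which remain.\<close>
    have "V (body C) \<subseteq> V [A]"
      unfolding V_head using * by (intro V_mono) (auto simp: vars_rule_def vars_query_def)
    moreover have "pred_sym A \<notin> F"
      using * sym by (auto simp: preds_rule_def)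
    ultimately show ?thesis
      using VQ by (auto simp: V_append V_Cons V_Nil)
  next
    assume *: "preds_rule C \<subseteq> F \<and> vars_rule C \<subseteq> vars_query (body C)"
    \<comment> \<open>Here \<open>A\<close> may have been the only cover of some variables. The body
      takes over this task: it inherits all variables of the instantiated \<open>A\<close>, and all
      its atoms are \<open>F\<close>-atoms.\<close>
    have "V [A] \<subseteq> V (body C)"
      unfolding V_head using * by (intro V_mono) (auto simp: vars_rule_def vars_query_def)
    moreover have "filter (\<lambda>A. pred_sym A \<in> F) (body C) = body C"
      using * by (auto simp: preds_rule_def intro!: filter_True)
    moreover have "pred_sym A \<in> F"
      using * sym by (auto simp: preds_rule_def)
    ultimately show ?thesis
      using VQ by (auto simp: V_append V_Cons V_Nil)
  qed
  then show ?thesis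
    unfolding Q' by (intro covered_subst) (simp add: V_def)
qed

text \<open>Induction on the number of steps. The program from which the input clause comes decides
  which alternative of \<open>covered_step\<close> applies; disjointness keeps the symbols of
  \<open>P1\<close>-clauses out of \<open>preds P2\<close>.\<close>

lemma covered_derivation:
  assumes D: "sld_derivation (P1 \<union> P2) D"
    and disj: "preds P1 \<inter> preds P2 = {}"
    and P1: "\<forall>C\<in>P1. vars_rule C \<subseteq> vars_atom (head C)"
    and P2: "\<forall>C\<in>P2. vars_rule C \<subseteq> vars_query (body C)"
    and cov: "covered (preds P2) (query_at D 0)"
    and "enat i \<le> len D"
  shows "covered (preds P2) (query_at D i)"
  using \<open>enat i \<le> len D\<close>
proof (induction i)
  case 0
  then show ?case using cov by simp
next
  case (Suc i)
  then have i: "enat i < len D"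
    by (simp add: Suc_ile_eq)
  obtain C where C: "C \<in> P1 \<union> P2" and var: "variant (clause_at D i) C"
    and step: "sld_step (query_at D i) (sel_at D i) (clause_at D i) (mgu_at D i) (query_at D (Suc i))"
    using D i unfolding sld_derivation_def by blast
  show ?case
  proof (rule covered_step[OF step])
    show "covered (preds P2) (query_at D i)"
      using Suc.IH i by simp
    show "preds_rule (clause_at D i) \<inter> preds P2 = {}
          \<and> vars_rule (clause_at D i) \<subseteq> vars_atom (head (clause_at D i))
        \<or> preds_rule (clause_at D i) \<subseteq> preds P2
          \<and> vars_rule (clause_at D i) \<subseteq> vars_query (body (clause_at D i))"
      using C
    proof
      assume "C \<in> P1"
      moreover from this have "preds_rule C \<subseteq> preds P1"
        by (auto simp: preds_def)
      ultimately show ?thesis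
        using variant_vars_head[OF var] preds_variant[OF var] P1 disj by blast
    next
      assume "C \<in> P2"
      moreover from this have "preds_rule C \<subseteq> preds P2"
        by (auto simp: preds_def)
      ultimately show ?thesis
        using variant_vars_body[OF var] preds_variant[OF var] P2 by blast
    qed
  qed
qed

theorem theorem15:
  fixes P1 P2 :: "('p, 'f, 'v) program"
    and F1 F2 :: "'p pred_sym set"
    and R :: "('p, 'f, 'v) selection"
    and Q :: "('p, 'f, 'v) query"
  assumes "F1 = preds P1" and "F2 = preds P2"
    and "F1 \<inter> F2 = {}"
    and "\<forall>C\<in>P1. vars_rule C \<subseteq> vars_atom (head C)"
    and "\<forall>C\<in>P2. vars_rule C \<subseteq> vars_query (body C)"
    and "partial_selection_rule R"
    and "\<forall>D i. derivation_via (P1 \<union> P2) R D \<and> floundered_at R D i \<longrightarrow>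
           (\<forall>A\<in>set (query_at D i). pred_sym A \<in> F1 \<and> \<not> ground_atom A)"
    and "\<forall>x\<in>vars_query Q. \<exists>A\<in>set Q. pred_sym A \<in> F2 \<and> x \<in> vars_atom A"
  shows "\<forall>D. derivation_via (P1 \<union> P2) R D \<and> query_at D 0 = Q \<longrightarrow> \<not> flounders R D"
proof (intro allI impI notI)
  fix D :: "('p, 'f, 'v) derivation"
  assume D: "derivation_via (P1 \<union> P2) R D \<and> query_at D 0 = Q" and "flounders R D"
  then obtain i where fl: "floundered_at R D i"
    by (auto simp: flounders_def)
  have sld: "sld_derivation (P1 \<union> P2) D"
    using D by (simp add: derivation_via_def)
  have "covered F2 (query_at D 0)"
    using assms(8) D by (simp add: covered_def)
  moreover have "enat i \<le> len D"
    using fl by (simp add: floundered_at_def)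
  ultimately have cov: "covered F2 (query_at D i)"
    using covered_derivation[OF sld] assms(1-5) by metis
  obtain A where A: "A \<in> set (query_at D i)"
    using fl by (cases "query_at D i") (auto simp: floundered_at_def)
  have F1: "\<forall>A\<in>set (query_at D i). pred_sym A \<in> F1 \<and> \<not> ground_atom A"
    using assms(7) D fl by blast
  \<comment> \<open>A floundered query is non-empty and its atoms are non-ground, so it contains a
    variable. The invariant puts that variable into an \<open>F2\<close>-atom of the query, which
    would also be an \<open>F1\<close>-atom.\<close>
  with A obtain x where "x \<in> vars_query (query_at D i)"
    unfolding ground_atom_def vars_query_def by blast
  with cov F1 assms(3) show False
    by (auto simp: covered_def)
qed

end
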